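(* For $\alpha,\beta,\gamma>0$ and $t>0$ put $$\Delta_T(t)=\left[E_{\alpha,\alpha+\beta}^{\gamma+1}(t^\alpha)\right]^2-E_{\alpha,\beta}^{\gamma}(t^\alpha)\,E_{\alpha,2\alpha+\beta}^{\gamma+2}(t^\alpha).$$ (i) For all $\alpha,\beta,\gamma>0$ and all $t\in(0,1)$, $$\Delta_T(t)\le\frac{1}{\gamma\,\Gamma_0\,t^\alpha(1-t^\alpha)^{2\gamma+1}}\left[\frac1{\Gamma_1}+\frac{t^\alpha}{\Gamma_2\,(1-t^\alpha)}\right],$$ where $\Gamma_p=\min_{n\in\mathbb N_p}\Gamma(\alpha n+\beta)$ for $p=0,1,2$ and $\mathbb N_p=\{p,p+1,p+2,\dots\}$. (ii) For all $\alpha\ge1$, $\beta\ge t_0$, $\gamma>0$ and all $t>0$, $$\Delta_T(t)\le\frac{{}_1F_1(\gamma;\beta;t^\alpha)}{\gamma\,\Gamma(\beta)\,t^\alpha}\left[\frac{{}_1F_1(\gamma+1;\alpha+\beta;t^\alpha)}{\Gamma(\alpha+\beta)}+\frac{t^\alpha\,{}_1F_1(\gamma+2;2\alpha+\beta;t^\alpha)}{\Gamma(2\alpha+\beta)}\right],$$ where $t_0$ is the point at which the Gamma function attains its minimum on $(0,\infty)$.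
   Context: The Prabhakar (three-parameter Mittag-Leffler) function is $$E_{\alpha,\beta}^{\gamma}(z)=\sum_{k\ge 0}\frac{(\gamma)_k}{\Gamma(\alpha k+\beta)}\frac{z^k}{k!},\qquad \alpha,\beta,\gamma>0,\ z\in\mathbb C,$$ where $(\lambda)_k=\Gamma(\lambda+k)/\Gamma(\lambda)$ is the Pochhammer symbol. Kummer's confluent hypergeometric function is ${}_1F_1(a;b;z)=\sum_{k\ge0}\frac{(a)_k}{(b)_k}\frac{z^k}{k!}$. The Gamma function has a unique minimum on $(0,\infty)$, attained at $t_0\approx1.46163$, with $\Gamma(t_0)\approx0.885603$. *)

theory Defs
  imports "HOL-Analysis.Analysis"
begin

text \<open>
  The parameters are real; the argument may be real or complex. At a real argument the real
  instance is the restriction of the complex one, and it is the one used in inequalities.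
\<close>

definition prabhakar ::
    "real \<Rightarrow> real \<Rightarrow> real \<Rightarrow> 'a \<Rightarrow> 'a :: {real_normed_field, banach}" where
  "prabhakar \<alpha> \<beta> \<gamma> z =
     (\<Sum>k. of_real (pochhammer \<gamma> k / Gamma (\<alpha> * real k + \<beta>)) * (z ^ k / fact k))"

definition kummer_1F1 :: "'a \<Rightarrow> 'a \<Rightarrow> 'a \<Rightarrow> 'a :: {real_normed_field, banach}" where
  "kummer_1F1 a b z = (\<Sum>k. pochhammer a k / pochhammer b k * (z ^ k / fact k))"

definition turan_diff :: "real \<Rightarrow> real \<Rightarrow> real \<Rightarrow> real \<Rightarrow> real" where
  "turan_diff \<alpha> \<beta> \<gamma> t =
     (prabhakar \<alpha> (\<alpha> + \<beta>) (\<gamma> + 1) (t powr \<alpha>))\<^sup>2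
     - prabhakar \<alpha> \<beta> \<gamma> (t powr \<alpha>) * prabhakar \<alpha> (2 * \<alpha> + \<beta>) (\<gamma> + 2) (t powr \<alpha>)"

text \<open>
  The index set is infinite, so \<^const>\<open>Min\<close> does not apply. The least element of the set of
  values exists for positive parameters, because the Gamma function is positive on the
  positive reals and tends to infinity.
\<close>

definition Gamma_min :: "real \<Rightarrow> real \<Rightarrow> nat \<Rightarrow> real" where
  "Gamma_min \<alpha> \<beta> p = (LEAST y. y \<in> (\<lambda>n. Gamma (\<alpha> * real n + \<beta>)) ` {p..})"

definition Gamma_argmin :: real where
  "Gamma_argmin = (THE t. is_arg_min (Gamma :: real \<Rightarrow> real) (\<lambda>s. 0 < s) t)"

end

theory Submission
  imports Defs
begin

text \<open>
  Put \<open>z = t powr \<alpha>\<close> and let \<open>f z\<close> be the series \<open>E0\<close> with parameters \<open>\<alpha>, \<beta>, \<gamma>\<close>.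
  Differentiation raises the parameters: the two other series are \<open>E1 = f' / \<gamma>\<close> and
  \<open>E2 = f'' / (\<gamma> (\<gamma> + 1))\<close>. A power series with nonnegative coefficients is log-convex
  in \<open>ln z\<close>, which in terms of the Euler operator \<open>\<theta> = z d/dz\<close> reads
  \<open>(\<theta> f)\<^sup>2 \<le> f * \<theta> (\<theta> f)\<close>. Written out with \<open>E0\<close>, \<open>E1\<close>, \<open>E2\<close> and solved for the
  Turan difference, this is
  \<open>E1\<^sup>2 - E0 * E2 \<le> E0 * (E1 + z * E2) / (\<gamma> * z)\<close>  (lemma \<open>prabhakar_turan\<close>).
  The right-hand side is increasing in the three nonnegative values \<open>E0\<close>, \<open>E1\<close>, \<open>E2\<close>, so any
  majorants of them give a bound (lemma \<open>turan_diff_le_majorants\<close>). Both bounds of the theorem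
  are of this form.

  For the first, the Gamma values in the denominators are replaced by their minimum, and
  what remains is the binomial series of \<open>(1 - z) powr (- \<gamma>)\<close>, and of the same power with
  \<open>\<gamma> + 1\<close> and \<open>\<gamma> + 2\<close>. For the second, Gamma increases to the right of its minimum point,
  so for \<open>\<alpha> \<ge> 1\<close> the denominator \<open>Gamma (\<alpha> k + b)\<close> can be replaced by
  \<open>Gamma (k + b) = Gamma b * pochhammer b k\<close>, which leaves a Kummer series.
\<close>

section \<open>Log-convexity of the Prabhakar series\<close>

text \<open>
  With \<open>a k\<close> replaced by \<open>c k * z ^ k\<close>, the three sums are \<open>f\<close>, \<open>\<theta> f\<close> and \<open>\<theta> (\<theta> f)\<close>, so this is
  the log-convexity described above. The reason is the Cauchy-Schwarz inequality: the
  variance of the index under the weights \<open>a\<close> is nonnegative.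
\<close>

lemma moments_log_convex:
  fixes a :: "nat \<Rightarrow> real"
  assumes nonneg: "\<And>k. 0 \<le> a k"
    and S0: "a sums S0" and S1: "(\<lambda>k. real k * a k) sums S1" and S2: "(\<lambda>k. (real k)\<^sup>2 * a k) sums S2"
    and pos: "0 < S0"
  shows "S1\<^sup>2 \<le> S0 * S2"
proof -
  \<comment> \<open>the mean of the index\<close>
  define m where "m = S1 / S0"
  have "(\<lambda>k. (real k)\<^sup>2 * a k - (2 * m) * (real k * a k) + m\<^sup>2 * a k) sums (S2 - (2 * m) * S1 + m\<^sup>2 * S0)"
    by (intro sums_add sums_diff sums_mult S0 S1 S2)
  moreover have "(real k)\<^sup>2 * a k - (2 * m) * (real k * a k) + m\<^sup>2 * a k = (real k - m)\<^sup>2 * a k" for k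
    by (simp add: power2_eq_square algebra_simps)
  ultimately have sums: "(\<lambda>k. (real k - m)\<^sup>2 * a k) sums (S2 - (2 * m) * S1 + m\<^sup>2 * S0)"
    by simp
  have "0 \<le> (real k - m)\<^sup>2 * a k" for k
    using nonneg by simp
  then have "0 \<le> S2 - (2 * m) * S1 + m\<^sup>2 * S0"
    by (rule sums_le[OF _ sums_zero sums])
  also have "\<dots> = S2 - S1\<^sup>2 / S0"
    using pos by (simp add: m_def power2_eq_square)
  finally show ?thesis
    using pos by (simp add: field_simps)
qed

definition prabhakar_term :: "real \<Rightarrow> real \<Rightarrow> real \<Rightarrow> real \<Rightarrow> nat \<Rightarrow> real" where
  "prabhakar_term \<alpha> \<beta> \<gamma> z k =
     pochhammer \<gamma> k * (z ^ k / fact k) / Gamma (\<alpha> * real k + \<beta>)"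

lemma prabhakar_eq_suminf: "prabhakar \<alpha> \<beta> \<gamma> z = suminf (prabhakar_term \<alpha> \<beta> \<gamma> z)"
  unfolding prabhakar_def by (rule suminf_cong) (simp add: prabhakar_term_def mult.commute)

lemma prabhakar_term_pos:
  assumes "0 < \<alpha>" "0 < \<beta>" "0 < \<gamma>" "0 < z"
  shows "0 < prabhakar_term \<alpha> \<beta> \<gamma> z k"
proof -
  have "0 < \<alpha> * real k + \<beta>"
    using assms by (intro add_nonneg_pos mult_nonneg_nonneg) auto
  then show ?thesis
    unfolding prabhakar_term_def using assms
    by (intro divide_pos_pos mult_pos_pos pochhammer_pos Gamma_real_pos) auto
qed

lemma prabhakar_nonneg:
  assumes "0 < \<alpha>" "0 < \<beta>" "0 < \<gamma>" "0 < z" "summable (prabhakar_term \<alpha> \<beta> \<gamma> z)"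
  shows "0 \<le> prabhakar \<alpha> \<beta> \<gamma> z"
  unfolding prabhakar_eq_suminf
  using assms by (intro suminf_nonneg) (simp_all add: less_imp_le prabhakar_term_pos)

text \<open>
  This is \<open>\<theta> E0 = \<gamma> z E1\<close> coefficient by coefficient. The identity is kept at the level of
  terms, so that the moments of the coefficients of \<open>E0\<close> are evaluated by shifting the index
  instead of differentiating a power series.
\<close>

lemma prabhakar_term_shift:
  "\<gamma> * z * prabhakar_term \<alpha> (\<alpha> + \<beta>) (\<gamma> + 1) z k
     = real (Suc k) * prabhakar_term \<alpha> \<beta> \<gamma> z (Suc k)"
proof -
  have arg: "\<alpha> * real k + (\<alpha> + \<beta>) = \<alpha> * real (Suc k) + \<beta>"
    by (simp add: algebra_simps)
  have monomial: "z * (z ^ k / fact k) = real (Suc k) * (z ^ Suc k / fact (Suc k))"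
    by (simp add: divide_simps del: of_nat_Suc)
  have "\<gamma> * z * prabhakar_term \<alpha> (\<alpha> + \<beta>) (\<gamma> + 1) z k
      = \<gamma> * pochhammer (\<gamma> + 1) k / Gamma (\<alpha> * real k + (\<alpha> + \<beta>)) * (z * (z ^ k / fact k))"
    by (simp add: prabhakar_term_def mult_ac)
  also have "\<dots> = real (Suc k) * prabhakar_term \<alpha> \<beta> \<gamma> z (Suc k)"
    unfolding arg monomial by (simp add: prabhakar_term_def pochhammer_rec mult_ac del: of_nat_Suc)
  finally show ?thesis .
qed

text \<open>
  The weights are the terms of \<open>E0\<close>: their first moment is \<open>\<gamma> z E1\<close>, and since
  \<open>k\<^sup>2 = k + k (k - 1)\<close> their second moment is \<open>\<gamma> z E1 + \<gamma> (\<gamma> + 1) z\<^sup>2 E2\<close>. The right-hand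
  side is the excess \<open>\<gamma> z (E1 + z E2)\<close> of the second moment over \<open>(\<gamma> z)\<^sup>2 E2\<close>, times
  \<open>E0 / (\<gamma> z)\<^sup>2\<close>.
\<close>

lemma prabhakar_turan:
  assumes par: "0 < \<alpha>" "0 < \<beta>" "0 < \<gamma>" "0 < z"
    and sum0: "summable (prabhakar_term \<alpha> \<beta> \<gamma> z)"
    and sum1: "summable (prabhakar_term \<alpha> (\<alpha> + \<beta>) (\<gamma> + 1) z)"
    and sum2: "summable (prabhakar_term \<alpha> (2 * \<alpha> + \<beta>) (\<gamma> + 2) z)"
  defines "E0 \<equiv> prabhakar \<alpha> \<beta> \<gamma> z"
    and "E1 \<equiv> prabhakar \<alpha> (\<alpha> + \<beta>) (\<gamma> + 1) z"
    and "E2 \<equiv> prabhakar \<alpha> (2 * \<alpha> + \<beta>) (\<gamma> + 2) z"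
  shows "E1\<^sup>2 - E0 * E2 \<le> E0 * (E1 + z * E2) / (\<gamma> * z)"
proof -
  define a where "a = prabhakar_term \<alpha> \<beta> \<gamma> z"
  define b where "b = prabhakar_term \<alpha> (\<alpha> + \<beta>) (\<gamma> + 1) z"
  define c where "c = prabhakar_term \<alpha> (2 * \<alpha> + \<beta>) (\<gamma> + 2) z"
  have a: "a sums E0" and b: "b sums E1" and c: "c sums E2"
    using sum0 sum1 sum2
    by (simp_all add: a_def b_def c_def E0_def E1_def E2_def prabhakar_eq_suminf summable_sums)
  have ab: "\<gamma> * z * b k = real (Suc k) * a (Suc k)" for k
    unfolding a_def b_def by (rule prabhakar_term_shift)
  have "2 * \<alpha> + \<beta> = \<alpha> + (\<alpha> + \<beta>)" "\<gamma> + 2 = (\<gamma> + 1) + 1"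
    by simp_all
  then have bc: "(\<gamma> + 1) * z * c k = real (Suc k) * b (Suc k)" for k
    unfolding b_def c_def by (metis prabhakar_term_shift)
  have "(\<lambda>k. real (Suc k) * a (Suc k)) sums (\<gamma> * z * E1)"
    unfolding ab[symmetric] by (intro sums_mult b)
  then have A1: "(\<lambda>k. real k * a k) sums (\<gamma> * z * E1)"
    using sums_Suc_iff[of "\<lambda>k. real k * a k"] by simp
  \<comment> \<open>The index shift turns the second moment of \<open>a\<close> into \<open>\<gamma> z\<close> times the zeroth plus the first
     moment of \<open>b\<close>, and a second shift turns the first moment of \<open>b\<close> into a multiple of \<open>E2\<close>.\<close>
  have "(\<lambda>k. real (Suc k) * b (Suc k)) sums ((\<gamma> + 1) * z * E2)"
    unfolding bc[symmetric] by (intro sums_mult c)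
  then have "(\<lambda>k. real k * b k) sums ((\<gamma> + 1) * z * E2)"
    using sums_Suc_iff[of "\<lambda>k. real k * b k"] by simp
  then have weighted: "(\<lambda>k. \<gamma> * z * (b k + real k * b k)) sums (\<gamma> * z * (E1 + (\<gamma> + 1) * z * E2))"
    by (rule sums_mult[OF sums_add[OF b]])
  have "\<gamma> * z * (b k + real k * b k) = real (Suc k) * (\<gamma> * z * b k)" for k
    by (simp add: algebra_simps)
  then have square: "\<gamma> * z * (b k + real k * b k) = (real (Suc k))\<^sup>2 * a (Suc k)" for k
    by (simp only: ab power2_eq_square mult.assoc[of "real (Suc k)"])
  have "(\<lambda>k. (real (Suc k))\<^sup>2 * a (Suc k)) sums (\<gamma> * z * (E1 + (\<gamma> + 1) * z * E2))"
    using weighted unfolding square .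
  then have A2: "(\<lambda>k. (real k)\<^sup>2 * a k) sums (\<gamma> * z * (E1 + (\<gamma> + 1) * z * E2))"
    using sums_Suc_iff[of "\<lambda>k. (real k)\<^sup>2 * a k"] by simp
  have a_pos: "0 < a k" for k
    unfolding a_def using par by (rule prabhakar_term_pos)
  have "0 < E0"
    using suminf_pos[OF sums_summable[OF a] a_pos] unfolding sums_unique[OF a, symmetric] .
  then have "(\<gamma> * z * E1)\<^sup>2 \<le> E0 * (\<gamma> * z * (E1 + (\<gamma> + 1) * z * E2))"
    by (rule moments_log_convex[OF less_imp_le[OF a_pos] a A1 A2])
  then have "(\<gamma> * z) * (\<gamma> * z * E1\<^sup>2) \<le> (\<gamma> * z) * (E0 * (E1 + (\<gamma> + 1) * z * E2))"
    by (simp only: power2_eq_square mult_ac)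
  then have "\<gamma> * z * E1\<^sup>2 \<le> E0 * (E1 + (\<gamma> + 1) * z * E2)"
    using par by (simp only: mult_le_cancel_left_pos[OF mult_pos_pos])
  then have "\<gamma> * z * (E1\<^sup>2 - E0 * E2) \<le> E0 * (E1 + z * E2)"
    by (simp add: algebra_simps)
  then show ?thesis
    using par by (simp only: pos_le_divide_eq[OF mult_pos_pos] mult.commute[of "\<gamma> * z"])
qed

section \<open>Majorants for the three series\<close>

lemma turan_diff_le_majorants:
  assumes par: "0 < \<alpha>" "0 < \<beta>" "0 < \<gamma>" "0 < t"
    and sum0: "summable (prabhakar_term \<alpha> \<beta> \<gamma> (t powr \<alpha>))"
    and sum1: "summable (prabhakar_term \<alpha> (\<alpha> + \<beta>) (\<gamma> + 1) (t powr \<alpha>))"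
    and sum2: "summable (prabhakar_term \<alpha> (2 * \<alpha> + \<beta>) (\<gamma> + 2) (t powr \<alpha>))"
    and le0: "prabhakar \<alpha> \<beta> \<gamma> (t powr \<alpha>) \<le> U0"
    and le1: "prabhakar \<alpha> (\<alpha> + \<beta>) (\<gamma> + 1) (t powr \<alpha>) \<le> U1"
    and le2: "prabhakar \<alpha> (2 * \<alpha> + \<beta>) (\<gamma> + 2) (t powr \<alpha>) \<le> U2"
  shows "turan_diff \<alpha> \<beta> \<gamma> t \<le> U0 * (U1 + t powr \<alpha> * U2) / (\<gamma> * t powr \<alpha>)"
proof -
  let ?z = "t powr \<alpha>"
  have z: "0 < ?z"
    using par by simp
  have "turan_diff \<alpha> \<beta> \<gamma> t \<le> prabhakar \<alpha> \<beta> \<gamma> ?z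
      * (prabhakar \<alpha> (\<alpha> + \<beta>) (\<gamma> + 1) ?z + ?z * prabhakar \<alpha> (2 * \<alpha> + \<beta>) (\<gamma> + 2) ?z)
      / (\<gamma> * ?z)"
    unfolding turan_diff_def using prabhakar_turan[OF par(1-3) z sum0 sum1 sum2] .
  also have "\<dots> \<le> U0 * (U1 + ?z * U2) / (\<gamma> * ?z)"
  proof (intro divide_right_mono mult_mono add_mono order_refl le0 le1 le2)
    have nonneg: "0 \<le> prabhakar \<alpha> \<beta> \<gamma> ?z" "0 \<le> prabhakar \<alpha> (\<alpha> + \<beta>) (\<gamma> + 1) ?z"
      "0 \<le> prabhakar \<alpha> (2 * \<alpha> + \<beta>) (\<gamma> + 2) ?z"
      using par z sum0 sum1 sum2 by (auto intro!: prabhakar_nonneg)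
    then show "0 \<le> U0" "0 \<le> prabhakar \<alpha> (2 * \<alpha> + \<beta>) (\<gamma> + 2) ?z"
      "0 \<le> prabhakar \<alpha> (\<alpha> + \<beta>) (\<gamma> + 1) ?z + ?z * prabhakar \<alpha> (2 * \<alpha> + \<beta>) (\<gamma> + 2) ?z"
      using le0 z by auto
  qed (use par z in auto)
  finally show ?thesis .
qed

lemma pochhammer_exp_series_sums:
  fixes z c :: real
  assumes "\<bar>z\<bar> < 1"
  shows "(\<lambda>k. pochhammer c k * (z ^ k / fact k)) sums (1 - z) powr (- c)"
proof -
  have "(- c gchoose k) * (- z) ^ k = pochhammer c k * (z ^ k / fact k)" for k
    by (simp add: gbinomial_pochhammer uminus_power_if)
  then show ?thesis
    using gen_binomial_real[of "- z" "- c"] assms by simp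
qed

lemma prabhakar_le_binomial:
  assumes "0 < c" "0 < z" "z < 1" "0 < m"
    and m: "\<And>k. m \<le> Gamma (\<alpha> * real k + b)"
  shows "summable (prabhakar_term \<alpha> b c z)"
    and "prabhakar \<alpha> b c z \<le> (1 - z) powr (- c) / m"
proof -
  have sums: "(\<lambda>k. pochhammer c k * (z ^ k / fact k) / m) sums ((1 - z) powr (- c) / m)"
    using assms by (intro sums_divide pochhammer_exp_series_sums) auto
  have nonneg: "0 \<le> pochhammer c k * (z ^ k / fact k)" for k
    using assms by (intro mult_nonneg_nonneg pochhammer_nonneg) auto
  have le: "prabhakar_term \<alpha> b c z k \<le> pochhammer c k * (z ^ k / fact k) / m" for k
    unfolding prabhakar_term_def using nonneg assms by (intro divide_left_mono mult_pos_pos) (auto intro: less_le_trans)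
  have "0 \<le> prabhakar_term \<alpha> b c z k" for k
    unfolding prabhakar_term_def using nonneg less_le_trans[OF \<open>0 < m\<close> m] by (intro divide_nonneg_pos)
  then show summ: "summable (prabhakar_term \<alpha> b c z)"
    using le by (intro summable_comparison_test'[OF sums_summable[OF sums]]) auto
  show "prabhakar \<alpha> b c z \<le> (1 - z) powr (- c) / m"
    unfolding prabhakar_eq_suminf by (rule sums_le[OF le summable_sums[OF summ] sums])
qed

text \<open>
  Ratio test: the quotient of consecutive Pochhammer quotients is \<open>(c + k) / (b + k)\<close>, which stays
  below a constant \<open>M\<close>, while \<open>\<bar>z\<bar> / (k + 1)\<close> eventually drops below \<open>1 / (2 M)\<close>.
\<close>

lemma summable_kummer:
  fixes b c z :: real
  assumes "0 < b" "0 < c"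
  shows "summable (\<lambda>k. pochhammer c k / pochhammer b k * (z ^ k / fact k))"
    (is "summable ?f")
proof -
  define M where "M = max 1 (c / b)"
  define N where "N = nat \<lceil>2 * M * \<bar>z\<bar>\<rceil>"
  have ratio: "(c + real k) / (b + real k) \<le> M" for k
  proof -
    have "c \<le> M * b" "real k \<le> M * real k"
      using assms mult_right_mono[of 1 M "real k"] by (auto simp: M_def field_simps max_def)
    then have "c + real k \<le> M * (b + real k)"
      by (simp add: algebra_simps)
    then show ?thesis
      using assms by (simp add: divide_le_eq)
  qed
  show ?thesis
  proof (rule summable_ratio_test[of "1/2" N])
    fix k assume "N \<le> k"
    then have k: "2 * M * \<bar>z\<bar> \<le> real (Suc k)"
      unfolding N_def by linarith
    have "?f (Suc k) = ((c + real k) / (b + real k) * (z / real (Suc k))) * ?f k"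
      by (simp add: pochhammer_Suc mult_ac)
    then have "norm (?f (Suc k)) = ((c + real k) / (b + real k) * \<bar>z\<bar> / real (Suc k)) * norm (?f k)"
      using assms by (simp add: abs_mult del: of_nat_Suc)
    also have "\<dots> \<le> 1 / 2 * norm (?f k)"
    proof (rule mult_right_mono)
      have "(c + real k) / (b + real k) * \<bar>z\<bar> \<le> M * \<bar>z\<bar>"
        using ratio by (rule mult_right_mono) simp
      also have "\<dots> \<le> 1 / 2 * real (Suc k)"
        using k by simp
      finally show "(c + real k) / (b + real k) * \<bar>z\<bar> / real (Suc k) \<le> 1 / 2"
        by (simp only: pos_divide_le_eq[OF of_nat_0_less_iff[THEN iffD2, OF zero_less_Suc]])
    qed simp
    finally show "norm (?f (Suc k)) \<le> 1 / 2 * norm (?f k)" .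
  qed simp
qed

lemma prabhakar_le_kummer:
  assumes "0 < b" "0 < c" "0 < z"
    and Gamma_le: "\<And>k. Gamma (b + real k) \<le> Gamma (\<alpha> * real k + b)"
  shows "summable (prabhakar_term \<alpha> b c z)"
    and "prabhakar \<alpha> b c z \<le> kummer_1F1 c b z / Gamma b"
proof -
  let ?f = "\<lambda>k. pochhammer c k / pochhammer b k * (z ^ k / fact k)"
  have sums: "(\<lambda>k. ?f k / Gamma b) sums (kummer_1F1 c b z / Gamma b)"
    unfolding kummer_1F1_def
    by (intro sums_divide summable_sums summable_kummer assms)
  have G: "0 < Gamma (b + real k)" for k
    using assms by auto
  have eq: "?f k / Gamma b = pochhammer c k * (z ^ k / fact k) / Gamma (b + real k)" for k
  proof -
    have "b \<notin> \<int>\<^sub>\<le>\<^sub>0"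
      using \<open>0 < b\<close> by (auto elim!: nonpos_Ints_cases)
    moreover have "Gamma b \<noteq> 0"
      using Gamma_real_pos[OF \<open>0 < b\<close>] by simp
    ultimately have "pochhammer b k * Gamma b = Gamma (b + real k)"
      by (simp add: pochhammer_Gamma)
    then show ?thesis
      unfolding \<open>pochhammer b k * Gamma b = _\<close>[symmetric] by simp
  qed
  have nonneg: "0 \<le> pochhammer c k * (z ^ k / fact k)" for k
    using assms by (intro mult_nonneg_nonneg pochhammer_nonneg) auto
  have le: "prabhakar_term \<alpha> b c z k \<le> ?f k / Gamma b" for k
    unfolding eq prabhakar_term_def
    using nonneg[of k] G[of k] Gamma_le[of k]
    by (intro divide_left_mono mult_pos_pos) auto
  have "0 \<le> prabhakar_term \<alpha> b c z k" for k
    unfolding prabhakar_term_def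
    using nonneg less_le_trans[OF G Gamma_le] by (intro divide_nonneg_pos)
  then show summ: "summable (prabhakar_term \<alpha> b c z)"
    using le by (intro summable_comparison_test'[OF sums_summable[OF sums]]) auto
  show "prabhakar \<alpha> b c z \<le> kummer_1F1 c b z / Gamma b"
    unfolding prabhakar_eq_suminf by (rule sums_le[OF le summable_sums[OF summ] sums])
qed

section \<open>Minima of the Gamma function\<close>

text \<open>
  \<^const>\<open>Gamma_min\<close> is a least element of an infinite set of reals and means nothing until that
  element is known to exist. It does, because Gamma increases from \<open>3 / 2\<close> on: the values with
  large index exceed that at a fixed index \<open>N\<close>, and only a finite set has to be minimised.
\<close>

lemma Gamma_min_attained:
  assumes "0 < \<alpha>" "0 < \<beta>"
  obtains n where "p \<le> n" "Gamma_min \<alpha> \<beta> p = Gamma (\<alpha> * real n + \<beta>)"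
    "\<And>k. p \<le> k \<Longrightarrow> Gamma_min \<alpha> \<beta> p \<le> Gamma (\<alpha> * real k + \<beta>)"
proof -
  let ?g = "\<lambda>n. Gamma (\<alpha> * real n + \<beta>)"
  define N where "N = max p (nat \<lceil>3 / (2 * \<alpha>)\<rceil>)"
  have "3 / (2 * \<alpha>) \<le> real N"
    unfolding N_def by linarith
  then have N: "3 / 2 \<le> \<alpha> * real N + \<beta>"
    using assms by (simp add: field_simps)
  have tail: "?g N \<le> ?g k" if "N \<le> k" for k
  proof (cases "k = N")
    case False
    then have "\<alpha> * real N + \<beta> < \<alpha> * real k + \<beta>"
      using that assms by simp
    then show ?thesis
      using Gamma_real_strict_mono[OF N] by (simp add: less_imp_le)
  qed simp
  have "finite {p..N}" "{p..N} \<noteq> {}"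
    by (simp_all add: N_def)
  from arg_min_if_finite[OF this, of ?g] obtain n where
    n: "n \<in> {p..N}" and min: "\<And>k. k \<in> {p..N} \<Longrightarrow> ?g n \<le> ?g k"
    by (meson not_le)
  have all: "?g n \<le> ?g k" if "p \<le> k" for k
  proof (cases "k \<le> N")
    case False
    have "?g n \<le> ?g N"
      using min by (simp add: N_def)
    also have "\<dots> \<le> ?g k"
      using tail False by simp
    finally show ?thesis .
  qed (use min that in auto)
  have "Gamma_min \<alpha> \<beta> p = ?g n"
    unfolding Gamma_min_def by (rule Least_equality) (use n all in auto)
  then show thesis
    using that n all by auto
qed

text \<open>
  The derivative of Gamma is Gamma times Digamma. Rolle's theorem and \<open>Gamma 1 = Gamma 2\<close> give a
  zero \<open>x0\<close> of Digamma; since Digamma is strictly increasing, Gamma strictly decreases up to \<open>x0\<close>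
  and strictly increases after it. So \<open>x0\<close> is the only minimum point, which the definite
  description in the definition of \<^const>\<open>Gamma_argmin\<close> requires.
\<close>

lemma Gamma_argmin_properties:
  shows Gamma_argmin_pos: "0 < Gamma_argmin"
    and Gamma_mono_above_argmin: "\<And>x y. Gamma_argmin \<le> x \<Longrightarrow> x \<le> y \<Longrightarrow> Gamma x \<le> Gamma y"
proof -
  have deriv: "(Gamma has_real_derivative Gamma x * Digamma x) (at x)" if "0 < x" for x :: real
    using that by (intro derivative_eq_intros) (auto elim!: nonpos_Ints_cases)
  have cont: "continuous_on A Gamma" if "A \<subseteq> {0<..}" for A :: "real set"
    using that deriv DERIV_isCont by (intro continuous_at_imp_continuous_on) blast
  have "Gamma 1 = Gamma (2 :: real)"
    using Gamma_plus1[of "1 :: real"] by simp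
  then have "\<exists>x0::real. 1 < x0 \<and> x0 < 2 \<and> (Gamma has_real_derivative 0) (at x0)"
  proof (intro Rolle)
    show "continuous_on {1..2::real} Gamma"
      by (rule cont) auto
    show "Gamma differentiable (at x)" if "1 < x" for x :: real
      using deriv[of x] that by (auto simp: real_differentiable_def)
  qed auto
  then obtain x0 :: real where x0: "1 < x0" "x0 < 2" "(Gamma has_real_derivative 0) (at x0)"
    by blast
  then have "Gamma x0 * Digamma x0 = 0"
    using DERIV_unique[OF deriv[of x0]] by simp
  then have D0: "Digamma x0 = 0"
    using Gamma_real_pos[of x0] x0 by (auto simp del: Gamma_real_pos)
  have mvt: "\<exists>\<xi>. x < \<xi> \<and> \<xi> < y \<and> Gamma y - Gamma x = (y - x) * (Gamma \<xi> * Digamma \<xi>)"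
    if "0 < x" "x < y" for x y :: real
    using that deriv by (intro MVT2) auto
  have up: "Gamma x < Gamma y" if "x0 \<le> x" "x < y" for x y
  proof -
    have "0 < x"
      using that x0 by simp
    from mvt[OF this \<open>x < y\<close>] obtain \<xi>
      where \<xi>: "x < \<xi>" "Gamma y - Gamma x = (y - x) * (Gamma \<xi> * Digamma \<xi>)"
      by blast
    then have "0 < Digamma \<xi>"
      using Digamma_real_strict_mono[of x0 \<xi>] D0 x0 that by simp
    then have "0 < (y - x) * (Gamma \<xi> * Digamma \<xi>)"
      using \<xi>(1) that x0 by (intro mult_pos_pos Gamma_real_pos) auto
    then show ?thesis
      using \<xi>(2) by simp
  qed
  have down: "Gamma y < Gamma x" if "0 < x" "x < y" "y \<le> x0" for x y
  proof -
    from mvt[OF \<open>0 < x\<close> \<open>x < y\<close>] obtain \<xi>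
      where \<xi>: "x < \<xi>" "\<xi> < y" "Gamma y - Gamma x = (y - x) * (Gamma \<xi> * Digamma \<xi>)"
      by blast
    then have "Digamma \<xi> < 0"
      using Digamma_real_strict_mono[of \<xi> x0] D0 that by simp
    then have "(y - x) * (Gamma \<xi> * Digamma \<xi>) < 0"
      using \<xi>(1) that by (intro mult_pos_neg Gamma_real_pos) auto
    then show ?thesis
      using \<xi>(3) by simp
  qed
  have less: "Gamma x0 < Gamma x" if "0 < x" "x \<noteq> x0" for x
    using up[of x0 x] down[of x x0] that by (cases "x < x0") auto
  have "Gamma_argmin = x0"
    unfolding Gamma_argmin_def is_arg_min_def
  proof (rule the_equality)
    have "\<not> Gamma y < Gamma x0" if "0 < y" for y
      using less[OF that] by (cases "y = x0") auto
    then show "0 < x0 \<and> \<not> (\<exists>y>0. Gamma y < Gamma x0)"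
      using x0 by auto
    show "x = x0" if "0 < x \<and> \<not> (\<exists>y>0. Gamma y < Gamma x)" for x
    proof (rule ccontr)
      assume "x \<noteq> x0"
      then have "Gamma x0 < Gamma x"
        using less that by blast
      moreover have "0 < x0"
        using x0 by simp
      ultimately show False
        using that by blast
    qed
  qed
  then show "0 < Gamma_argmin" "\<And>x y. Gamma_argmin \<le> x \<Longrightarrow> x \<le> y \<Longrightarrow> Gamma x \<le> Gamma y"
    using x0 up by (auto simp: order_le_less)
qed

section \<open>The two bounds\<close>

lemma turan_diff_le_binomial:
  assumes par: "0 < \<alpha>" "0 < \<beta>" "0 < \<gamma>" "0 < t" "t < 1"
  shows "turan_diff \<alpha> \<beta> \<gamma> t
    \<le> 1 / (\<gamma> * Gamma_min \<alpha> \<beta> 0 * t powr \<alpha> * (1 - t powr \<alpha>) powr (2 * \<gamma> + 1))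
      * (1 / Gamma_min \<alpha> \<beta> 1 + t powr \<alpha> / (Gamma_min \<alpha> \<beta> 2 * (1 - t powr \<alpha>)))"
proof -
  define z where "z = t powr \<alpha>"
  define G where "G = Gamma_min \<alpha> \<beta>"
  have z: "0 < z" "z < 1"
    using par powr_less_mono2[of \<alpha> t 1] by (simp_all add: z_def)
  have G_pos: "0 < G p" for p
    using Gamma_min_attained[OF par(1,2), of p] par
    by (metis G_def Gamma_real_pos add_nonneg_pos less_imp_le mult_nonneg_nonneg of_nat_0_le_iff)
  \<comment> \<open>The series shifted \<open>p\<close> times sees only the Gamma values with index at least \<open>p\<close>.\<close>
  have G_le: "G p \<le> Gamma (\<alpha> * real k + (real p * \<alpha> + \<beta>))" for p k
  proof -
    have "G p \<le> Gamma (\<alpha> * real (p + k) + \<beta>)"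
      using Gamma_min_attained[OF par(1,2), of p] by (metis G_def le_add1)
    then show ?thesis
      by (simp add: algebra_simps)
  qed
  note E0 = prabhakar_le_binomial[OF par(3) z G_pos G_le[of 0], simplified]
  note E1 = prabhakar_le_binomial[OF _ z G_pos G_le[of 1], of "\<gamma> + 1", simplified]
  note E2 = prabhakar_le_binomial[OF _ z G_pos G_le[of 2], of "\<gamma> + 2", simplified]
  have "turan_diff \<alpha> \<beta> \<gamma> t \<le> (1 - z) powr (- \<gamma>) / G 0
      * ((1 - z) powr (- (\<gamma> + 1)) / G 1 + z * ((1 - z) powr (- (\<gamma> + 2)) / G 2)) / (\<gamma> * z)"
    unfolding z_def
    by (rule turan_diff_le_majorants) (use par E0 E1 E2 in \<open>simp_all add: z_def\<close>)
  also have "\<dots> = 1 / (\<gamma> * G 0 * z * (1 - z) powr (2 * \<gamma> + 1)) * (1 / G 1 + z / (G 2 * (1 - z)))"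
  proof -
    define w q where "w = 1 - z" and "q = w powr \<gamma>"
    have "0 < w" "0 < q"
      using z by (simp_all add: w_def q_def)
    have "2 * \<gamma> + 1 = \<gamma> + \<gamma> + 1"
      by simp
    then have powers: "w powr (- \<gamma>) = 1 / q" "w powr (- (\<gamma> + 1)) = 1 / (q * w)"
      "w powr (- (\<gamma> + 2)) = 1 / (q * (w * w))" "w powr (2 * \<gamma> + 1) = q * q * w"
      using \<open>0 < w\<close> unfolding q_def powr_minus_divide
      by (simp_all only: powr_add powr_one powr_numeral power2_eq_square less_imp_le)
    have "G 0 \<noteq> 0" "G 1 \<noteq> 0" "G 2 \<noteq> 0"
      using G_pos[of 0] G_pos[of 1] G_pos[of 2] by simp_all
    moreover have "w \<noteq> 0" "q \<noteq> 0" "z \<noteq> 0" "\<gamma> \<noteq> 0"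
      using \<open>0 < w\<close> \<open>0 < q\<close> z par by simp_all
    ultimately show ?thesis
      unfolding w_def[symmetric] powers by (simp add: field_simps)
  qed
  finally show ?thesis
    unfolding z_def G_def .
qed

lemma turan_diff_le_kummer:
  assumes "1 \<le> \<alpha>" "Gamma_argmin \<le> \<beta>" "0 < \<gamma>" "0 < t"
  shows "turan_diff \<alpha> \<beta> \<gamma> t
    \<le> kummer_1F1 \<gamma> \<beta> (t powr \<alpha>) / (\<gamma> * Gamma \<beta> * t powr \<alpha>)
      * (kummer_1F1 (\<gamma> + 1) (\<alpha> + \<beta>) (t powr \<alpha>) / Gamma (\<alpha> + \<beta>)
         + t powr \<alpha> * kummer_1F1 (\<gamma> + 2) (2 * \<alpha> + \<beta>) (t powr \<alpha>) / Gamma (2 * \<alpha> + \<beta>))"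
proof -
  have par: "0 < \<alpha>" "0 < \<beta>" and z: "0 < t powr \<alpha>"
    using assms Gamma_argmin_pos by auto
  have G: "Gamma (b + real k) \<le> Gamma (\<alpha> * real k + b)" if "Gamma_argmin \<le> b" for b k
    using mult_right_mono[OF \<open>1 \<le> \<alpha>\<close>, of "real k"] that
    by (intro Gamma_mono_above_argmin) auto
  have above: "Gamma_argmin \<le> \<alpha> + \<beta>" "Gamma_argmin \<le> 2 * \<alpha> + \<beta>"
    using assms by auto
  note E0 = prabhakar_le_kummer[OF _ _ z G[OF assms(2)], of \<gamma>]
  note E1 = prabhakar_le_kummer[OF _ _ z G[OF above(1)], of "\<gamma> + 1"]
  note E2 = prabhakar_le_kummer[OF _ _ z G[OF above(2)], of "\<gamma> + 2"]
  have "turan_diff \<alpha> \<beta> \<gamma> t \<le> kummer_1F1 \<gamma> \<beta> (t powr \<alpha>) / Gamma \<beta>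
      * (kummer_1F1 (\<gamma> + 1) (\<alpha> + \<beta>) (t powr \<alpha>) / Gamma (\<alpha> + \<beta>)
         + t powr \<alpha> * (kummer_1F1 (\<gamma> + 2) (2 * \<alpha> + \<beta>) (t powr \<alpha>) / Gamma (2 * \<alpha> + \<beta>)))
      / (\<gamma> * t powr \<alpha>)"
    by (rule turan_diff_le_majorants) (use par assms E0 E1 E2 in simp_all)
  then show ?thesis
    by (simp add: mult_ac)
qed

theorem theorem3:
  shows "(\<forall>\<alpha> \<beta> \<gamma> t :: real. 0 < \<alpha> \<longrightarrow> 0 < \<beta> \<longrightarrow> 0 < \<gamma> \<longrightarrow> 0 < t \<longrightarrow> t < 1 \<longrightarrow>
            turan_diff \<alpha> \<beta> \<gamma> t
              \<le> 1 / (\<gamma> * Gamma_min \<alpha> \<beta> 0 * t powr \<alpha> * (1 - t powr \<alpha>) powr (2 * \<gamma> + 1))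
                * (1 / Gamma_min \<alpha> \<beta> 1
                   + t powr \<alpha> / (Gamma_min \<alpha> \<beta> 2 * (1 - t powr \<alpha>))))
       \<and> (\<forall>\<alpha> \<beta> \<gamma> t :: real. 1 \<le> \<alpha> \<longrightarrow> Gamma_argmin \<le> \<beta> \<longrightarrow> 0 < \<gamma> \<longrightarrow> 0 < t \<longrightarrow>
            turan_diff \<alpha> \<beta> \<gamma> t
              \<le> kummer_1F1 \<gamma> \<beta> (t powr \<alpha>) / (\<gamma> * Gamma \<beta> * t powr \<alpha>)
                * (kummer_1F1 (\<gamma> + 1) (\<alpha> + \<beta>) (t powr \<alpha>) / Gamma (\<alpha> + \<beta>)
                   + t powr \<alpha> * kummer_1F1 (\<gamma> + 2) (2 * \<alpha> + \<beta>) (t powr \<alpha>)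
                     / Gamma (2 * \<alpha> + \<beta>)))"
  using turan_diff_le_binomial turan_diff_le_kummer by blast

end
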